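(* Let $\Delta x,\Delta t>0$ and $\lambda\in\mathbb{R}$, and for each $i\in\mathbb Z$ set $$\varphi_{i,0}=\frac{u_{i,1}^2+u_{i,0}^2+u_{i,0}u_{i,1}}{6}+D_m^2\mu_n u_{i-1,0}+\lambda\, D_nD_m\mu_m u_{i-1,0}.$$ Consider the scheme $\widetilde{\mathcal A}(\lambda)=0$ for the KdV equation $\mathcal A\equiv u_t+uu_x+u_{xxx}=0$, where $$\widetilde{\mathcal A}(\lambda)=D_m\left(\widetilde{F_1}\right)+D_n\left(\widetilde{G_1}\right),\qquad \widetilde{F_1}=\mu_m\varphi_{-1,0},\qquad \widetilde{G_1}=u_{0,0}.$$ (i) The scheme preserves the discrete mass conservation law $\widetilde{\mathcal A}(\lambda)=D_m(\widetilde{F_1})+D_n(\widetilde{G_1})=0$ and also a discrete energy conservation law: identically in the grid function $u$, $$\widetilde{\mathcal Q_3}\,\widetilde{\mathcal A}(\lambda)=D_m\widetilde{F_3}+D_n\widetilde{G_3},$$ where $$\widetilde{\mathcal Q_3}=2\varphi_{0,0},\qquad \widetilde{G_3}=\tfrac13u_{0,0}^3+u_{0,0}D_m^2u_{-1,0},$$ $$\widetilde{F_3}=\varphi_{0,0}\varphi_{-1,0}+(D_m\mu_nu_{-1,0})(D_n\mu_mu_{-1,0})-(\mu_m\mu_nu_{-1,0})(D_nD_mu_{-1,0})+\lambda(D_nu_{0,0})(D_nu_{-1,0}).$$ (ii) If $\lambda=\lambda(\Delta x,\Delta t)=\mathcal O(\Delta x^2)+\mathcal O(\Delta t^2)$,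 then $\widetilde{\mathcal A}(\lambda)$ and $\widetilde{\mathcal Q_3}$ are second-order accurate approximations, at the centre $(x_0,t_0+\Delta t/2)$ of the stencil, of $\mathcal A=u_t+uu_x+u_{xxx}$ and of $\mathcal Q_3=u^2+2u_{xx}$ respectively; that is, when $u_{i,j}=u(x_i,t_j)$ for a smooth function $u$, the differences $\widetilde{\mathcal A}(\lambda)-\mathcal A$ and $\widetilde{\mathcal Q_3}-\mathcal Q_3$ at that point are $\mathcal O(\Delta x^2)+\mathcal O(\Delta t^2)$.
   Context: Discrete setting: a uniform grid with stepsizes $\Delta x,\Delta t$. Relative to a generic lattice point $(m,n)\in\mathbb{Z}^2$, the grid points are $x_i=x(m)+i\Delta x$, $t_j=t(n)+j\Delta t$, and $u_{i,j}$ denotes the value of the grid function at $(x_i,t_j)$. The forward shifts are $S_m:u_{i,j}\mapsto u_{i+1,j}$ and $S_n:u_{i,j}\mapsto u_{i,j+1}$, extended to functions of finitely many $u_{i,j}$ (so $S_m\varphi_{i,0}=\varphi_{i+1,0}$). With $I$ the identity, $$D_m=\tfrac1{\Delta x}(S_m-I),\quad \mu_m=\tfrac12(S_m+I),\quad D_n=\tfrac1{\Delta t}(S_n-I),\quad \mu_n=\tfrac12(S_n+I);$$ these operators commute. Operators written to the left of a variable act on that variable only, within the enclosing brackets. A scheme $\widetilde{\mathcal A}=0$ preserves a discrete conservation law with characteristic $\widetilde{\mathcal Q}$ if $\widetilde{\mathcal Q}\widetilde{\mathcal A}=D_m(\widetilde F)+D_n(\widetilde G)$ identically, for some functions $\widetilde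 F,\widetilde G$ of finitely many shifts of $u_{0,0}$. The continuous KdV mass and energy conservation laws have characteristics $1$ and $\mathcal Q_3=u^2+2u_{xx}$ and are $D_t(u)+D_x(\frac12u^2+u_{xx})=0$ and $D_t(\frac13u^3+uu_{xx})+D_x(\frac14u^4+u_xu_t-uu_{xt}+u^2u_{xx}+u_{xx}^2)=0$. *)

theory Defs
  imports "HOL-Analysis.Analysis" "HOL-Library.Landau_Symbols"
begin

text \<open>
  A grid function is indexed relative to a generic lattice point \<open>(m, n)\<close>, so \<open>u i j\<close> is
  \<open>u\<^sub>i\<^sub>,\<^sub>j\<close>. An expression in the \<open>u\<^sub>i\<^sub>,\<^sub>j\<close> is a functional of the grid function; the forward shifts
  act on it by translating its argument, so that \<open>S_m (U i j) = U (i + 1) j\<close> and the shifts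
  are multiplicative.
\<close>

type_synonym grid_fun = "int \<Rightarrow> int \<Rightarrow> real"
type_synonym diff_fun = "grid_fun \<Rightarrow> real"

definition U :: "int \<Rightarrow> int \<Rightarrow> diff_fun" where
  "U i j = (\<lambda>u. u i j)"

definition S_m :: "diff_fun \<Rightarrow> diff_fun" where
  "S_m F = (\<lambda>u. F (\<lambda>i j. u (i + 1) j))"

definition S_n :: "diff_fun \<Rightarrow> diff_fun" where
  "S_n F = (\<lambda>u. F (\<lambda>i j. u i (j + 1)))"

definition D_m :: "real \<Rightarrow> diff_fun \<Rightarrow> diff_fun" where
  "D_m \<Delta>x F = (\<lambda>u. (S_m F u - F u) / \<Delta>x)"

definition D_n :: "real \<Rightarrow> diff_fun \<Rightarrow> diff_fun" where
  "D_n \<Delta>t F = (\<lambda>u. (S_n F u - F u) / \<Delta>t)"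

definition \<mu>_m :: "diff_fun \<Rightarrow> diff_fun" where
  "\<mu>_m F = (\<lambda>u. (S_m F u + F u) / 2)"

definition \<mu>_n :: "diff_fun \<Rightarrow> diff_fun" where
  "\<mu>_n F = (\<lambda>u. (S_n F u + F u) / 2)"

definition finitely_many_shifts :: "diff_fun \<Rightarrow> bool" where
  "finitely_many_shifts F \<longleftrightarrow>
     (\<exists>S. finite S \<and> (\<forall>u v. (\<forall>(i, j)\<in>S. u i j = v i j) \<longrightarrow> F u = F v))"

text \<open>
  The scheme \<open>A = 0\<close> preserves the discrete conservation law \<open>D_m F + D_n G = 0\<close> with
  characteristic \<open>Q\<close>.
\<close>

definition preserves_claw ::
    "real \<Rightarrow> real \<Rightarrow> diff_fun \<Rightarrow> diff_fun \<Rightarrow> diff_fun \<Rightarrow> diff_fun \<Rightarrow> bool" where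
  "preserves_claw \<Delta>x \<Delta>t A Q F G \<longleftrightarrow>
     finitely_many_shifts F \<and> finitely_many_shifts G \<and>
     (\<forall>u. Q u * A u = D_m \<Delta>x F u + D_n \<Delta>t G u)"

definition \<phi> :: "real \<Rightarrow> real \<Rightarrow> real \<Rightarrow> int \<Rightarrow> diff_fun" where
  "\<phi> \<Delta>x \<Delta>t lam i = (\<lambda>u.
     ((U i 1 u)\<^sup>2 + (U i 0 u)\<^sup>2 + U i 0 u * U i 1 u) / 6
     + D_m \<Delta>x (D_m \<Delta>x (\<mu>_n (U (i - 1) 0))) u
     + lam * D_n \<Delta>t (D_m \<Delta>x (\<mu>_m (U (i - 1) 0))) u)"

definition F1 :: "real \<Rightarrow> real \<Rightarrow> real \<Rightarrow> diff_fun" where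
  "F1 \<Delta>x \<Delta>t lam = \<mu>_m (\<phi> \<Delta>x \<Delta>t lam (-1))"

definition G1 :: diff_fun where
  "G1 = U 0 0"

definition scheme :: "real \<Rightarrow> real \<Rightarrow> real \<Rightarrow> diff_fun" where
  "scheme \<Delta>x \<Delta>t lam = (\<lambda>u. D_m \<Delta>x (F1 \<Delta>x \<Delta>t lam) u + D_n \<Delta>t G1 u)"

definition Q3 :: "real \<Rightarrow> real \<Rightarrow> real \<Rightarrow> diff_fun" where
  "Q3 \<Delta>x \<Delta>t lam = (\<lambda>u. 2 * \<phi> \<Delta>x \<Delta>t lam 0 u)"

definition G3 :: "real \<Rightarrow> diff_fun" where
  "G3 \<Delta>x = (\<lambda>u. 1 / 3 * (U 0 0 u) ^ 3 + U 0 0 u * D_m \<Delta>x (D_m \<Delta>x (U (-1) 0)) u)"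

definition F3 :: "real \<Rightarrow> real \<Rightarrow> real \<Rightarrow> diff_fun" where
  "F3 \<Delta>x \<Delta>t lam = (\<lambda>u.
     \<phi> \<Delta>x \<Delta>t lam 0 u * \<phi> \<Delta>x \<Delta>t lam (-1) u
     + D_m \<Delta>x (\<mu>_n (U (-1) 0)) u * D_n \<Delta>t (\<mu>_m (U (-1) 0)) u
     - \<mu>_m (\<mu>_n (U (-1) 0)) u * D_n \<Delta>t (D_m \<Delta>x (U (-1) 0)) u
     + lam * D_n \<Delta>t (U 0 0) u * D_n \<Delta>t (U (-1) 0) u)"

definition pd_x :: "(real \<Rightarrow> real \<Rightarrow> real) \<Rightarrow> real \<Rightarrow> real \<Rightarrow> real" where
  "pd_x u = (\<lambda>x t. deriv (\<lambda>y. u y t) x)"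

definition pd_t :: "(real \<Rightarrow> real \<Rightarrow> real) \<Rightarrow> real \<Rightarrow> real \<Rightarrow> real" where
  "pd_t u = (\<lambda>x t. deriv (\<lambda>s. u x s) t)"

primrec C_k :: "nat \<Rightarrow> (real \<Rightarrow> real \<Rightarrow> real) \<Rightarrow> bool" where
  "C_k 0 u \<longleftrightarrow> continuous_on UNIV (\<lambda>(x, t). u x t)"
| "C_k (Suc k) u \<longleftrightarrow>
     continuous_on UNIV (\<lambda>(x, t). u x t) \<and>
     (\<forall>x t. (\<lambda>y. u y t) differentiable (at x) \<and> (\<lambda>s. u x s) differentiable (at t)) \<and>
     C_k k (pd_x u) \<and> C_k k (pd_t u)"

definition smooth :: "(real \<Rightarrow> real \<Rightarrow> real) \<Rightarrow> bool" where
  "smooth u \<longleftrightarrow> (\<forall>k. C_k k u)"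

definition KdV :: "(real \<Rightarrow> real \<Rightarrow> real) \<Rightarrow> real \<Rightarrow> real \<Rightarrow> real" where
  "KdV u x t = pd_t u x t + u x t * pd_x u x t + pd_x (pd_x (pd_x u)) x t"

definition Q3_cont :: "(real \<Rightarrow> real \<Rightarrow> real) \<Rightarrow> real \<Rightarrow> real \<Rightarrow> real" where
  "Q3_cont u x t = (u x t)\<^sup>2 + 2 * pd_x (pd_x u) x t"

definition sample :: "(real \<Rightarrow> real \<Rightarrow> real) \<Rightarrow> real \<Rightarrow> real \<Rightarrow> real \<Rightarrow> real \<Rightarrow> grid_fun" where
  "sample u x0 t0 \<Delta>x \<Delta>t = (\<lambda>i j. u (x0 + of_int i * \<Delta>x) (t0 + of_int j * \<Delta>t))"

text \<open>
  The class \<open>O(\<Delta>x\<^sup>2) + O(\<Delta>t\<^sup>2)\<close> of functions of the step sizes, as both tend to \<open>0\<close> from above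
  independently of each other.
\<close>

definition second_order :: "(real \<times> real \<Rightarrow> real) set" where
  "second_order =
     {\<lambda>p. f p + g p | f g.
        f \<in> O[at_right 0 \<times>\<^sub>F at_right 0](\<lambda>(\<Delta>x, \<Delta>t). \<Delta>x\<^sup>2) \<and>
        g \<in> O[at_right 0 \<times>\<^sub>F at_right 0](\<lambda>(\<Delta>x, \<Delta>t). \<Delta>t\<^sup>2)}"

end

theory Submission
  imports Defs
begin

text \<open>
  Summation by parts: \<open>2 \<phi>\<^sub>0 D\<^sub>m \<mu>\<^sub>m \<phi>\<^sub>-\<^sub>1\<close> telescopes to \<open>D\<^sub>m (\<phi>\<^sub>0 \<phi>\<^sub>-\<^sub>1)\<close>, and \<open>2 \<phi>\<^sub>0 D\<^sub>n u\<^sub>0\<^sub>,\<^sub>0\<close> is a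
  discrete divergence in which \<open>\<lambda>\<close> only enters the flux.

  For the accuracy, Taylor expansion with remainders uniform on a compact box gives the spatial
  differences at the two time levels, and a second expansion about \<open>t\<^sub>0 + \<Delta>t / 2\<close> averages these.
  The two expansions are never mixed; mixed derivatives only occur in the terms multiplied by
  \<open>\<lambda>\<close>, where boundedness suffices.
\<close>

section \<open>Exact algebra: locality of the fluxes and the two conservation laws\<close>

lemmas difference_defs = U_def S_m_def S_n_def D_m_def D_n_def \<mu>_m_def \<mu>_n_def

lemma finitely_many_shiftsI:
  assumes "\<And>u v. (\<And>i j. \<bar>i\<bar> \<le> N \<Longrightarrow> \<bar>j\<bar> \<le> N \<Longrightarrow> u i j = v i j) \<Longrightarrow> F u = F v"
  shows "finitely_many_shifts F"
  unfolding finitely_many_shifts_def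
proof (intro exI conjI allI impI)
  show "finite ({-N..N} \<times> {-N..N})" by simp
next
  fix u v :: grid_fun
  assume "\<forall>(i, j)\<in>{-N..N} \<times> {-N..N}. u i j = v i j"
  then show "F u = F v" by (intro assms) (auto simp: abs_le_iff)
qed

lemma finitely_many_shifts_fluxes:
  "finitely_many_shifts (F1 \<Delta>x \<Delta>t lam)" "finitely_many_shifts G1"
  "finitely_many_shifts (F3 \<Delta>x \<Delta>t lam)" "finitely_many_shifts (G3 \<Delta>x)"
  \<comment> \<open>Every index in the four fluxes has modulus at most 2, the extreme being -2 in
    \<open>\<phi>\<close> at -1, so the box of radius 3 covers them.\<close>
  by (rule finitely_many_shiftsI[where N = 3];
      simp add: F1_def G1_def F3_def G3_def \<phi>_def difference_defs)+

text \<open>\<open>D_m\<close> after \<open>\<mu>_m\<close> is a central difference of width two: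
  the two copies of \<open>\<phi>\<close> at index 0 cancel.\<close>

lemma scheme_eq:
  "scheme \<Delta>x \<Delta>t lam u =
     (\<phi> \<Delta>x \<Delta>t lam 1 u - \<phi> \<Delta>x \<Delta>t lam (-1) u) / (2 * \<Delta>x) + (u 0 1 - u 0 0) / \<Delta>t"
  by (simp add: scheme_def F1_def G1_def \<phi>_def difference_defs
      diff_divide_distrib add_divide_distrib)

lemma energy_identity:
  assumes "\<Delta>x > 0" "\<Delta>t > 0"
  shows "Q3 \<Delta>x \<Delta>t lam u * scheme \<Delta>x \<Delta>t lam u =
           D_m \<Delta>x (F3 \<Delta>x \<Delta>t lam) u + D_n \<Delta>t (G3 \<Delta>x) u"
proof -
  define f where "f = (\<lambda>i. \<phi> \<Delta>x \<Delta>t lam i u)"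
  define R where "R = (\<lambda>u. D_m \<Delta>x (\<mu>_n (U (-1) 0)) u * D_n \<Delta>t (\<mu>_m (U (-1) 0)) u
     - \<mu>_m (\<mu>_n (U (-1) 0)) u * D_n \<Delta>t (D_m \<Delta>x (U (-1) 0)) u
     + lam * D_n \<Delta>t (U 0 0) u * D_n \<Delta>t (U (-1) 0) u)"
  \<comment> \<open>Inverse stepsizes turn the identity below into a polynomial one in
    \<open>H\<close>, \<open>K\<close> and the grid values.\<close>
  define H K where "H = inverse \<Delta>x" and "K = inverse \<Delta>t"
  have f: "\<phi> \<Delta>x \<Delta>t lam i u = f i" for i by (simp add: f_def)
  \<comment> \<open>Translating the grid function raises the index of \<open>\<phi>\<close>, which
    makes \<open>D_m\<close> telescope on the product of neighbouring values.\<close>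
  have shift: "\<phi> \<Delta>x \<Delta>t lam i (\<lambda>i j. u (i + 1) j) = f (i + 1)" for i
    by (simp add: f_def \<phi>_def difference_defs algebra_simps)
  \<comment> \<open>Three identities add up. The cubic part is u1^3 - u0^3 = (u1 - u0)(u1^2 + u1 u0
    + u0^2). With a = \<open>\<mu>_n\<close> u and b = \<open>D_n\<close> u, the dispersive part
    exceeds the time difference in \<open>G3\<close> by the discrete Wronskian b D^2 a - a D^2 b,
    the spatial difference of the two middle terms of \<open>R\<close>. The \<open>lam\<close> part
    is lam * b_0 (b_1 - b_(-1)) / \<open>\<Delta>x\<close>, which telescopes.\<close>
  have rest: "2 * f 0 * (u 0 1 - u 0 0) * K = D_m \<Delta>x R u + D_n \<Delta>t (G3 \<Delta>x) u"
    unfolding f_def \<phi>_def R_def G3_def difference_defs divide_inverse H_def[symmetric] K_def[symmetric]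
    by (simp add: algebra_simps power2_eq_square power3_eq_cube)
      (simp add: field_simps)
  have "F3 \<Delta>x \<Delta>t lam = (\<lambda>u. \<phi> \<Delta>x \<Delta>t lam 0 u * \<phi> \<Delta>x \<Delta>t lam (-1) u + R u)"
    by (simp add: F3_def R_def algebra_simps)
  then have F3: "D_m \<Delta>x (F3 \<Delta>x \<Delta>t lam) u = (f 1 * f 0 - f 0 * f (-1)) * H + D_m \<Delta>x R u"
    using shift[of 0] shift[of "-1"]
    by (simp add: D_m_def S_m_def f divide_inverse H_def algebra_simps)
  have "Q3 \<Delta>x \<Delta>t lam u * scheme \<Delta>x \<Delta>t lam u =
          (f 1 * f 0 - f 0 * f (-1)) * H + 2 * f 0 * (u 0 1 - u 0 0) * K"
    unfolding scheme_eq Q3_def f H_def K_def using assms by (simp add: field_simps)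
  then show ?thesis unfolding F3 rest by simp
qed

section \<open>Smooth functions: boundedness on boxes and Taylor expansion with uniform
  remainder\<close>

lemma smooth_pd:
  assumes "smooth u"
  shows smooth_pd_x: "smooth (pd_x u)" and smooth_pd_t: "smooth (pd_t u)"
  using assms unfolding smooth_def by (metis C_k.simps(2))+

lemma smooth_pd_x_iter: "smooth u \<Longrightarrow> smooth ((pd_x ^^ n) u)"
  by (induction n) (auto intro: smooth_pd_x)

lemma smooth_has_derivative:
  assumes "smooth u"
  shows smooth_DERIV_x: "((\<lambda>y. u y t) has_real_derivative pd_x u x t) (at x)"
    and smooth_DERIV_t: "((\<lambda>s. u x s) has_real_derivative pd_t u x t) (at t)"
proof -
  have "C_k (Suc 0) u" using assms by (simp add: smooth_def)
  then show "((\<lambda>y. u y t) has_real_derivative pd_x u x t) (at x)"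
    "((\<lambda>s. u x s) has_real_derivative pd_t u x t) (at t)"
    by (auto simp: pd_x_def pd_t_def DERIV_deriv_iff_real_differentiable)
qed

text \<open>The recursion treats both variables alike, so exchanging them merely exchanges
  \<open>pd_x\<close> and \<open>pd_t\<close>. This lets the expansion in time be read off from the
  one in space.\<close>

lemma C_k_swap: "C_k k u \<Longrightarrow> C_k k (\<lambda>x t. u t x)"
proof (induction k arbitrary: u)
  have swap: "continuous_on UNIV (\<lambda>(x, t). u t x)"
    if "continuous_on UNIV (\<lambda>(x, t). u x t)" for u :: "real \<Rightarrow> real \<Rightarrow> real"
    using continuous_on_compose2[OF that continuous_on_swap[of UNIV]]
    by (simp add: case_prod_unfold prod.swap_def)
  {
    case 0
    then show ?case by (simp add: swap)
  next
    case (Suc k)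
    have "pd_x (\<lambda>x t. u t x) = (\<lambda>x t. pd_t u t x)" "pd_t (\<lambda>x t. u t x) = (\<lambda>x t. pd_x u t x)"
      by (simp_all add: pd_x_def pd_t_def)
    with Suc swap show ?case by simp
  }
qed

lemma smooth_swap: "smooth u \<Longrightarrow> smooth (\<lambda>x t. u t x)"
  by (simp add: smooth_def C_k_swap)

lemma pd_x_iter_swap: "(pd_x ^^ n) (\<lambda>x t. u t x) = (\<lambda>x t. (pd_t ^^ n) u t x)"
  by (induction n) (simp_all add: pd_x_def pd_t_def)

lemma smooth_bounded_on_box:
  assumes "smooth u"
  obtains M where "M \<ge> 0" "\<And>x t. \<bar>x\<bar> \<le> B \<Longrightarrow> \<bar>t\<bar> \<le> B \<Longrightarrow> \<bar>u x t\<bar> \<le> M"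
proof -
  let ?K = "{-B..B} \<times> {-B..B}"
  have "C_k 0 u" using assms unfolding smooth_def by blast
  then have "continuous_on ?K (\<lambda>(x, t). u x t)"
    by (auto intro: continuous_on_subset)
  then have "bounded ((\<lambda>(x, t). u x t) ` ?K)"
    by (intro compact_imp_bounded compact_continuous_image compact_Times) auto
  then obtain M where M: "\<forall>y\<in>(\<lambda>(x, t). u x t) ` ?K. \<bar>y\<bar> \<le> M"
    unfolding bounded_iff by auto
  show ?thesis
  proof (rule that[of "\<bar>M\<bar>"])
    fix x t :: real
    assume "\<bar>x\<bar> \<le> B" "\<bar>t\<bar> \<le> B"
    then have "(x, t) \<in> ?K" by auto
    then have "\<bar>u x t\<bar> \<le> M" using M by force
    then show "\<bar>u x t\<bar> \<le> \<bar>M\<bar>" by simp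
  qed simp
qed

text \<open>Lagrange's remainder with its derivative bounded by compactness. The range 2 for
  \<open>s\<close> reaches the outermost stencil points x0 - 2h and x0 + 2h when h \<le> 1.\<close>

lemma taylor_x:
  assumes "smooth u" "n > 0"
  obtains M where "M \<ge> 0"
    "\<And>x t s. \<bar>x\<bar> \<le> B \<Longrightarrow> \<bar>t\<bar> \<le> B \<Longrightarrow> \<bar>s\<bar> \<le> 2 \<Longrightarrow>
       \<bar>u (x + s) t - (\<Sum>m<n. (pd_x ^^ m) u x t / fact m * s ^ m)\<bar> \<le> M * \<bar>s\<bar> ^ n"
proof -
  \<comment> \<open>The box is enlarged by 2 so that it contains every intermediate point between
    \<open>x\<close> and \<open>x + s\<close>.\<close>
  obtain M where M: "M \<ge> 0" "\<And>x t. \<bar>x\<bar> \<le> B + 2 \<Longrightarrow> \<bar>t\<bar> \<le> B + 2 \<Longrightarrow> \<bar>(pd_x ^^ n) u x t\<bar> \<le> M"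
    using smooth_bounded_on_box[OF smooth_pd_x_iter[OF assms(1)]] by metis
  show ?thesis
  proof (rule that[OF M(1)])
    fix x t s :: real
    assume bd: "\<bar>x\<bar> \<le> B" "\<bar>t\<bar> \<le> B" "\<bar>s\<bar> \<le> 2"
    show "\<bar>u (x + s) t - (\<Sum>m<n. (pd_x ^^ m) u x t / fact m * s ^ m)\<bar> \<le> M * \<bar>s\<bar> ^ n"
    \<comment> \<open>Taylor's theorem asks for two distinct points; at \<open>s = 0\<close> only
      the constant term of the sum survives.\<close>
    proof (cases "s = 0")
      case True
      have "(\<Sum>m<n. (pd_x ^^ m) u x t / fact m * 0 ^ m) = (pd_x ^^ 0) u x t / fact 0"
        using assms(2) by (subst sum.remove[of _ 0]) (auto simp: power_0_left intro!: sum.neutral)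
      then show ?thesis using True assms(2) M(1) by simp
    next
      case False
      have "((\<lambda>y. (pd_x ^^ m) u y t) has_real_derivative (pd_x ^^ Suc m) u y t) (at y)" for m y
        using smooth_DERIV_x[OF smooth_pd_x_iter[OF assms(1)]] by simp
      then obtain \<xi> where \<xi>: "if x + s < x then x + s < \<xi> \<and> \<xi> < x else x < \<xi> \<and> \<xi> < x + s"
        and eq: "u (x + s) t = (\<Sum>m<n. (pd_x ^^ m) u x t / fact m * (x + s - x) ^ m)
                  + (pd_x ^^ n) u \<xi> t / fact n * (x + s - x) ^ n"
        using Taylor[of n "\<lambda>m y. (pd_x ^^ m) u y t" "\<lambda>y. u y t" "x - 2" "x + 2" x "x + s"]
          bd assms(2) False by (auto simp: abs_le_iff)
      have "\<bar>(pd_x ^^ n) u \<xi> t\<bar> \<le> M"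
        using \<xi> bd by (intro M(2)) (auto split: if_splits)
      then have "\<bar>(pd_x ^^ n) u \<xi> t\<bar> / fact n \<le> M / 1"
        using M(1) by (intro frac_le) auto
      then have "\<bar>(pd_x ^^ n) u \<xi> t / fact n\<bar> * \<bar>s\<bar> ^ n \<le> M * \<bar>s\<bar> ^ n"
        by (intro mult_right_mono) simp_all
      then show ?thesis unfolding eq by (simp add: abs_mult power_abs)
    qed
  qed
qed

lemma taylor_t:
  assumes "smooth u" "n > 0"
  obtains M where "M \<ge> 0"
    "\<And>x t s. \<bar>x\<bar> \<le> B \<Longrightarrow> \<bar>t\<bar> \<le> B \<Longrightarrow> \<bar>s\<bar> \<le> 2 \<Longrightarrow>
       \<bar>u x (t + s) - (\<Sum>m<n. (pd_t ^^ m) u x t / fact m * s ^ m)\<bar> \<le> M * \<bar>s\<bar> ^ n"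
proof -
  let ?v = "\<lambda>x t. u t x"
  obtain M where M: "M \<ge> 0"
    "\<And>x t s. \<bar>x\<bar> \<le> B \<Longrightarrow> \<bar>t\<bar> \<le> B \<Longrightarrow> \<bar>s\<bar> \<le> 2 \<Longrightarrow>
       \<bar>?v (x + s) t - (\<Sum>m<n. (pd_x ^^ m) ?v x t / fact m * s ^ m)\<bar> \<le> M * \<bar>s\<bar> ^ n"
    using taylor_x[OF smooth_swap[OF assms(1)] assms(2), where B = B] by blast
  show ?thesis
  proof (rule that[OF M(1)])
    fix x t s :: real
    assume "\<bar>x\<bar> \<le> B" "\<bar>t\<bar> \<le> B" "\<bar>s\<bar> \<le> 2"
    with M(2)[of t x s]
    show "\<bar>u x (t + s) - (\<Sum>m<n. (pd_t ^^ m) u x t / fact m * s ^ m)\<bar> \<le> M * \<bar>s\<bar> ^ n"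
      by (simp only: pd_x_iter_swap)
  qed
qed

section \<open>Calculus of second-order equivalence in the two stepsizes\<close>

text \<open>Splitting \<open>f\<close> in proportion to \<open>\<Delta>x\<^sup>2\<close> and \<open>\<Delta>t\<^sup>2\<close> turns one joint bound into two separate ones.\<close>

lemma second_order_eq:
  "second_order = O[at_right 0 \<times>\<^sub>F at_right 0](\<lambda>p. (fst p)\<^sup>2 + (snd p)\<^sup>2)"
proof (intro set_eqI iffI)
  fix F :: "real \<times> real \<Rightarrow> real"
  assume "F \<in> second_order"
  then obtain f g where "F = (\<lambda>p. f p + g p)"
    and "f \<in> O[at_right 0 \<times>\<^sub>F at_right 0](\<lambda>p. (fst p)\<^sup>2)"
    and "g \<in> O[at_right 0 \<times>\<^sub>F at_right 0](\<lambda>p. (snd p)\<^sup>2)"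
    unfolding second_order_def case_prod_beta' by blast
  moreover have "(\<lambda>p. (fst p)\<^sup>2) \<in> O[at_right 0 \<times>\<^sub>F at_right 0](\<lambda>p. (fst p)\<^sup>2 + (snd p)\<^sup>2 :: real)"
    "(\<lambda>p. (snd p)\<^sup>2) \<in> O[at_right 0 \<times>\<^sub>F at_right 0](\<lambda>p. (fst p)\<^sup>2 + (snd p)\<^sup>2 :: real)"
    by (intro bigoI[of _ 1] always_eventually; simp)+
  ultimately show "F \<in> O[at_right 0 \<times>\<^sub>F at_right 0](\<lambda>p. (fst p)\<^sup>2 + (snd p)\<^sup>2)"
    by (auto intro: sum_in_bigo landau_o.big_trans)
next
  fix F :: "real \<times> real \<Rightarrow> real"
  let ?q = "\<lambda>p :: real \<times> real. (fst p)\<^sup>2 + (snd p)\<^sup>2"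
  assume "F \<in> O[at_right 0 \<times>\<^sub>F at_right 0](?q)"
  then obtain C where C: "C > 0" "\<forall>\<^sub>F p in at_right 0 \<times>\<^sub>F at_right 0. \<bar>F p\<bar> \<le> C * \<bar>?q p\<bar>"
    by (auto elim!: landau_o.bigE)
  have bound: "\<bar>a * v / (v + w)\<bar> \<le> C * v \<and> \<bar>a - a * v / (v + w)\<bar> \<le> C * w"
    if "\<bar>a\<bar> \<le> C * \<bar>v + w\<bar>" "v \<ge> 0" "w \<ge> 0" for a v w :: real
  proof (cases "v + w = 0")
    \<comment> \<open>Here the hypothesis forces \<open>a = 0\<close>, and the quotient by zero has
      the default value 0, so both bounds are trivial.\<close>
    case True
    then have "a = 0" "v = 0" "w = 0" using that by auto
    then show ?thesis by simp
  next
    case False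
    then have pos: "v + w > 0" using that by simp
    then have le: "\<bar>a\<bar> / (v + w) \<le> C" using that(1) by (simp add: divide_le_eq)
    have "a - a * v / (v + w) = a * w / (v + w)" using False by (simp add: field_simps)
    then show ?thesis
      using mult_right_mono[OF le that(2)] mult_right_mono[OF le that(3)] that(2,3) pos
      by (simp add: abs_mult)
  qed
  let ?f = "\<lambda>p. F p * (fst p)\<^sup>2 / ?q p"
  have "?f \<in> O[at_right 0 \<times>\<^sub>F at_right 0](\<lambda>p. (fst p)\<^sup>2)"
    "(\<lambda>p. F p - ?f p) \<in> O[at_right 0 \<times>\<^sub>F at_right 0](\<lambda>p. (snd p)\<^sup>2)"
    by (intro bigoI[of _ C] eventually_mono[OF C(2)], simp only: real_norm_def abs_power2,
        rule bound[THEN conjunct1] bound[THEN conjunct2]; simp)+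
  moreover have "F = (\<lambda>p. ?f p + (F p - ?f p))" by simp
  ultimately show "F \<in> second_order"
    unfolding second_order_def case_prod_beta' mem_Collect_eq by (intro exI conjI)
qed

text \<open>Reduces every asymptotic claim to an estimate uniform on the unit square of stepsizes,
  where compactness arguments apply.\<close>

lemma eventually_small_steps:
  fixes P :: "real \<times> real \<Rightarrow> bool"
  assumes "\<And>h k. 0 < h \<Longrightarrow> h \<le> 1 \<Longrightarrow> 0 < k \<Longrightarrow> k \<le> 1 \<Longrightarrow> P (h, k)"
  shows "eventually P (at_right 0 \<times>\<^sub>F at_right 0)"
proof -
  have small: "\<forall>\<^sub>F x in at_right (0 :: real). 0 < x \<and> x \<le> 1"
    unfolding eventually_at_right[OF zero_less_one] by (intro exI[of _ 1]) auto
  show ?thesis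
    by (rule eventually_mono[OF eventually_prodI[OF small small]]) (use assms in auto)
qed

text \<open>Congruence modulo the error class: sums and products of difference quotients can then be
  treated factor by factor, with no explicit remainders.\<close>

definition second_order_equiv ::
    "(real \<Rightarrow> real \<Rightarrow> real) \<Rightarrow> (real \<Rightarrow> real \<Rightarrow> real) \<Rightarrow> bool" (infix "\<simeq>" 50) where
  "f \<simeq> g \<longleftrightarrow> (\<lambda>(h, k). f h k - g h k) \<in> second_order"

definition stays_bounded :: "(real \<Rightarrow> real \<Rightarrow> real) \<Rightarrow> bool" where
  "stays_bounded f \<longleftrightarrow> (\<lambda>(h, k). f h k) \<in> O[at_right 0 \<times>\<^sub>F at_right 0](\<lambda>_. 1)"

lemma second_order_equiv_iff:
  "f \<simeq> g \<longleftrightarrow> (\<lambda>p. f (fst p) (snd p) - g (fst p) (snd p))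
     \<in> O[at_right 0 \<times>\<^sub>F at_right 0](\<lambda>p. (fst p)\<^sup>2 + (snd p)\<^sup>2)"
  unfolding second_order_equiv_def second_order_eq by (simp add: case_prod_beta')

lemma second_order_equivI:
  assumes "\<And>h k. 0 < h \<Longrightarrow> h \<le> 1 \<Longrightarrow> 0 < k \<Longrightarrow> k \<le> 1 \<Longrightarrow> \<bar>f h k - g h k\<bar> \<le> M * (h\<^sup>2 + k\<^sup>2)"
  shows "f \<simeq> g"
  unfolding second_order_equiv_iff
  by (rule bigoI[of _ M], rule eventually_small_steps) (use assms in simp)

lemma stays_boundedI:
  assumes "\<And>h k. 0 < h \<Longrightarrow> h \<le> 1 \<Longrightarrow> 0 < k \<Longrightarrow> k \<le> 1 \<Longrightarrow> \<bar>f h k\<bar> \<le> M"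
  shows "stays_bounded f"
  unfolding stays_bounded_def
  by (rule bigoI[of _ M], rule eventually_small_steps) (use assms in simp)

lemma second_order_equiv_trans:
  assumes "f \<simeq> g" "g \<simeq> e"
  shows "f \<simeq> e"
  using sum_in_bigo(1)[OF assms[unfolded second_order_equiv_iff]]
  unfolding second_order_equiv_iff by simp

lemma second_order_equiv_add:
  assumes "f1 \<simeq> g1" "f2 \<simeq> g2"
  shows "(\<lambda>h k. f1 h k + f2 h k) \<simeq> (\<lambda>h k. g1 h k + g2 h k)"
  using sum_in_bigo(1)[OF assms[unfolded second_order_equiv_iff]]
  unfolding second_order_equiv_iff by (simp add: algebra_simps)

lemma second_order_equiv_cmult:
  assumes "f \<simeq> g"
  shows "(\<lambda>h k. c * f h k) \<simeq> (\<lambda>h k. c * g h k)"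
  using assms unfolding second_order_equiv_iff
  by (cases "c = 0") (simp_all add: right_diff_distrib[symmetric])

text \<open>Writing d1, d2 for the two errors, f1 f2 - g1 g2 = d1 d2 + d1 g2 + d2 g1. Errors in the
  class are themselves bounded, so boundedness is asked of the limits only.\<close>

lemma second_order_equiv_mult:
  assumes "f1 \<simeq> g1" "f2 \<simeq> g2" "stays_bounded g1" "stays_bounded g2"
  shows "(\<lambda>h k. f1 h k * f2 h k) \<simeq> (\<lambda>h k. g1 h k * g2 h k)"
proof -
  let ?F = "at_right 0 \<times>\<^sub>F at_right (0 :: real)"
  let ?q = "\<lambda>p :: real \<times> real. (fst p)\<^sup>2 + (snd p)\<^sup>2"
  have "?q \<in> O[?F](\<lambda>_. 1)"
  proof (rule bigoI[of _ 2], rule eventually_small_steps)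
    fix h k :: real
    assume "0 < h" "h \<le> 1" "0 < k" "k \<le> 1"
    then have "h\<^sup>2 \<le> 1" "k\<^sup>2 \<le> 1" by (simp_all add: power_le_one)
    then show "norm (?q (h, k)) \<le> 2 * norm (1 :: real)" by simp
  qed
  then have q: "F \<in> O[?F](?q) \<Longrightarrow> F \<in> O[?F](\<lambda>_. 1)" for F
    using landau_o.big_trans by blast
  have mult: "(\<lambda>p. F p * G p) \<in> O[?F](?q)" if "F \<in> O[?F](?q)" "G \<in> O[?F](\<lambda>_. 1)" for F G
    using landau_o.big.mult[OF that] by simp
  note eq = assms(1,2)[unfolded second_order_equiv_iff]
  note bd = assms(3,4)[unfolded stays_bounded_def case_prod_beta']
  note mult[OF eq(1) q[OF eq(2)]] mult[OF eq(1) bd(2)] mult[OF eq(2) bd(1)]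
  from sum_in_bigo(1)[OF this(1) sum_in_bigo(1)[OF this(2,3)]] show ?thesis
    unfolding second_order_equiv_iff by (simp add: algebra_simps)
qed

lemma second_order_mult_stays_bounded:
  assumes "(\<lambda>(h, k). f h k) \<in> second_order" "stays_bounded g"
  shows "(\<lambda>h k. f h k * g h k) \<simeq> (\<lambda>h k. 0)"
  using landau_o.big.mult[OF assms[unfolded second_order_eq stays_bounded_def case_prod_beta']]
  unfolding second_order_equiv_iff by simp

text \<open>Turns a Taylor remainder into the error of a difference quotient with denominator
  \<open>h ^ m\<close>. The equation for \<open>j\<close> is a separate premise so that numeral
  exponents can be matched.\<close>

lemma abs_divide_power_le:
  fixes h :: real
  assumes "0 < h" "\<bar>a\<bar> \<le> c * h ^ j" "j = m + n"
  shows "\<bar>a / h ^ m\<bar> \<le> c * h ^ n"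
  using assms by (simp add: divide_le_eq power_add mult_ac)


section \<open>Means, differences and increments in time at a fixed place\<close>

text \<open>Expanding both levels about their midpoint makes the linear terms opposite; the
  remainders at distance k/2 give \<open>M * k^2 / 4\<close>.\<close>

lemma second_order_equiv_time_mean:
  assumes "smooth u"
  shows "(\<lambda>h k. (u x0 (t0 + k) + u x0 t0) / 2) \<simeq> (\<lambda>h k. u x0 (t0 + k / 2))"
proof -
  obtain M where M: "M \<ge> 0"
    "\<And>x t s. \<bar>x\<bar> \<le> \<bar>x0\<bar> + \<bar>t0\<bar> + 1 \<Longrightarrow> \<bar>t\<bar> \<le> \<bar>x0\<bar> + \<bar>t0\<bar> + 1 \<Longrightarrow> \<bar>s\<bar> \<le> 2 \<Longrightarrow>
       \<bar>u x (t + s) - (\<Sum>m<2. (pd_t ^^ m) u x t / fact m * s ^ m)\<bar> \<le> M * \<bar>s\<bar> ^ 2"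
    using taylor_t[OF assms zero_less_numeral, where B = "\<bar>x0\<bar> + \<bar>t0\<bar> + 1"] by blast
  show ?thesis
  proof (rule second_order_equivI[of _ _ M])
    fix h k :: real
    assume "0 < h" "h \<le> 1" "0 < k" "k \<le> 1"
    then have "\<bar>u x0 (t0 + k) - (u x0 (t0 + k / 2) + pd_t u x0 (t0 + k / 2) * (k / 2))\<bar> \<le> M * k\<^sup>2 / 4"
      "\<bar>u x0 t0 - (u x0 (t0 + k / 2) - pd_t u x0 (t0 + k / 2) * (k / 2))\<bar> \<le> M * k\<^sup>2 / 4"
      using M(2)[of x0 "t0 + k / 2" "k / 2"] M(2)[of x0 "t0 + k / 2" "- k / 2"]
        abs_triangle_ineq[of t0 "k / 2"]
      by (simp_all add: numeral_2_eq_2 power2_eq_square add.commute)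
    note near = this
    \<comment> \<open>Stated for arbitrary reals, so that the sampled values enter as atoms of
      linear arithmetic.\<close>
    have "\<bar>(a + b) / 2 - c\<bar> \<le> e" if "\<bar>a - (c + d)\<bar> \<le> e" "\<bar>b - (c - d)\<bar> \<le> e"
      for a b c d e :: real using that by (auto simp: abs_le_iff field_simps)
    from this[OF near] have "\<bar>(u x0 (t0 + k) + u x0 t0) / 2 - u x0 (t0 + k / 2)\<bar> \<le> M * k\<^sup>2 / 4" .
    moreover have "0 \<le> M * h\<^sup>2" "0 \<le> M * k\<^sup>2" using M(1) by simp_all
    ultimately show "\<bar>(u x0 (t0 + k) + u x0 t0) / 2 - u x0 (t0 + k / 2)\<bar> \<le> M * (h\<^sup>2 + k\<^sup>2)"
      unfolding distrib_left by linarith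
  qed
qed

text \<open>About the midpoint the even terms cancel in the difference, so expansion to third order
  leaves O(k^3), and division by \<open>k\<close> leaves O(k^2).\<close>

lemma second_order_equiv_time_difference:
  assumes "smooth u"
  shows "(\<lambda>h k. (u x0 (t0 + k) - u x0 t0) / k) \<simeq> (\<lambda>h k. pd_t u x0 (t0 + k / 2))"
proof -
  obtain M where M: "M \<ge> 0"
    "\<And>x t s. \<bar>x\<bar> \<le> \<bar>x0\<bar> + \<bar>t0\<bar> + 1 \<Longrightarrow> \<bar>t\<bar> \<le> \<bar>x0\<bar> + \<bar>t0\<bar> + 1 \<Longrightarrow> \<bar>s\<bar> \<le> 2 \<Longrightarrow>
       \<bar>u x (t + s) - (\<Sum>m<3. (pd_t ^^ m) u x t / fact m * s ^ m)\<bar> \<le> M * \<bar>s\<bar> ^ 3"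
    using taylor_t[OF assms zero_less_numeral, where B = "\<bar>x0\<bar> + \<bar>t0\<bar> + 1"] by blast
  show ?thesis
  proof (rule second_order_equivI[of _ _ M])
    fix h k :: real
    assume hk: "0 < h" "h \<le> 1" "0 < k" "k \<le> 1"
    let ?c = "t0 + k / 2"
    have "\<bar>u x0 (t0 + k) - (u x0 ?c + pd_t u x0 ?c * (k / 2) + pd_t (pd_t u) x0 ?c / 2 * (k / 2)\<^sup>2)\<bar> \<le> M * k ^ 3 / 8"
      "\<bar>u x0 t0 - (u x0 ?c - pd_t u x0 ?c * (k / 2) + pd_t (pd_t u) x0 ?c / 2 * (k / 2)\<^sup>2)\<bar> \<le> M * k ^ 3 / 8"
      using hk M(2)[of x0 ?c "k / 2"] M(2)[of x0 ?c "- k / 2"]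
        abs_triangle_ineq[of t0 "k / 2"]
      by (simp_all add: numeral_3_eq_3 numeral_2_eq_2 add.commute)
    note near = this
    have "\<bar>a - b - 2 * d\<bar> \<le> 2 * e"
      if "\<bar>a - (c + d + r)\<bar> \<le> e" "\<bar>b - (c - d + r)\<bar> \<le> e"
      for a b c d e r :: real using that by (simp add: abs_le_iff)
    from this[OF near]
    have "\<bar>u x0 (t0 + k) - u x0 t0 - 2 * (pd_t u x0 ?c * (k / 2))\<bar> \<le> 2 * (M * k ^ 3 / 8)" .
    moreover have "0 \<le> M * h\<^sup>2" "0 \<le> M * k ^ 3" using M(1) hk by simp_all
    ultimately have "\<bar>u x0 (t0 + k) - u x0 t0 - k * pd_t u x0 ?c\<bar> \<le> M * k ^ 3"
      by (simp add: mult.commute)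
    from abs_divide_power_le[OF hk(3) this, of 1 2]
    show "\<bar>(u x0 (t0 + k) - u x0 t0) / k - pd_t u x0 (t0 + k / 2)\<bar> \<le> M * (h\<^sup>2 + k\<^sup>2)"
      using hk \<open>0 \<le> M * h\<^sup>2\<close> by (simp add: diff_divide_distrib distrib_left)
  qed
qed

text \<open>Each increment is O(k), so the product is O(k^2). Such products measure how far the
  quadratic terms are from products of time means.\<close>

lemma time_increments_negligible:
  assumes "smooth u" "smooth v"
  shows "(\<lambda>h k. (u x0 (t0 + k) - u x0 t0) * (v x0 (t0 + k) - v x0 t0)) \<simeq> (\<lambda>h k. 0)"
proof -
  obtain M where M: "M \<ge> 0"
    "\<And>x t s. \<bar>x\<bar> \<le> \<bar>x0\<bar> + \<bar>t0\<bar> \<Longrightarrow> \<bar>t\<bar> \<le> \<bar>x0\<bar> + \<bar>t0\<bar> \<Longrightarrow> \<bar>s\<bar> \<le> 2 \<Longrightarrow>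
       \<bar>u x (t + s) - (\<Sum>m<1. (pd_t ^^ m) u x t / fact m * s ^ m)\<bar> \<le> M * \<bar>s\<bar> ^ 1"
    using taylor_t[OF assms(1) zero_less_one, where B = "\<bar>x0\<bar> + \<bar>t0\<bar>"] by blast
  obtain N where N: "N \<ge> 0"
    "\<And>x t s. \<bar>x\<bar> \<le> \<bar>x0\<bar> + \<bar>t0\<bar> \<Longrightarrow> \<bar>t\<bar> \<le> \<bar>x0\<bar> + \<bar>t0\<bar> \<Longrightarrow> \<bar>s\<bar> \<le> 2 \<Longrightarrow>
       \<bar>v x (t + s) - (\<Sum>m<1. (pd_t ^^ m) v x t / fact m * s ^ m)\<bar> \<le> N * \<bar>s\<bar> ^ 1"
    using taylor_t[OF assms(2) zero_less_one, where B = "\<bar>x0\<bar> + \<bar>t0\<bar>"] by blast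
  show ?thesis
  proof (rule second_order_equivI[of _ _ "M * N"])
    fix h k :: real
    assume hk: "0 < h" "h \<le> 1" "0 < k" "k \<le> 1"
    have "\<bar>u x0 (t0 + k) - u x0 t0\<bar> \<le> M * k" "\<bar>v x0 (t0 + k) - v x0 t0\<bar> \<le> N * k"
      using hk M(2)[of x0 t0 k] N(2)[of x0 t0 k] by simp_all
    then have "\<bar>u x0 (t0 + k) - u x0 t0\<bar> * \<bar>v x0 (t0 + k) - v x0 t0\<bar> \<le> (M * k) * (N * k)"
      using M(1) hk by (intro mult_mono) simp_all
    then have "\<bar>(u x0 (t0 + k) - u x0 t0) * (v x0 (t0 + k) - v x0 t0)\<bar> \<le> M * N * k\<^sup>2"
      unfolding abs_mult by (simp only: power2_eq_square mult_ac)
    moreover have "0 \<le> M * N * h\<^sup>2" using M(1) N(1) by simp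
    ultimately show "\<bar>(u x0 (t0 + k) - u x0 t0) * (v x0 (t0 + k) - v x0 t0) - 0\<bar> \<le> M * N * (h\<^sup>2 + k\<^sup>2)"
      unfolding distrib_left by linarith
  qed
qed

section \<open>Symmetric spatial differences at one time level\<close>

text \<open>The function \<open>\<tau>\<close> stands for any of the times t0, t0 + k and t0 + k/2;
  keeping its values in one compact interval makes the bound independent of
  \<open>k\<close>.\<close>

lemma stays_bounded_sample:
  fixes \<tau> :: "real \<Rightarrow> real"
  assumes "smooth u" "\<tau> ` {0<..1} \<subseteq> {t0..t0 + 1}"
  shows "stays_bounded (\<lambda>h k. u x0 (\<tau> k))"
proof -
  let ?B = "\<bar>x0\<bar> + \<bar>t0\<bar> + 1"
  obtain M where "M \<ge> 0" and M: "\<And>x t. \<bar>x\<bar> \<le> ?B \<Longrightarrow> \<bar>t\<bar> \<le> ?B \<Longrightarrow> \<bar>u x t\<bar> \<le> M"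
    using smooth_bounded_on_box[OF assms(1), where B = ?B] by blast
  show ?thesis
  proof (rule stays_boundedI[of _ M])
    fix h k :: real
    assume "0 < k" "k \<le> 1"
    with assms(2) have "t0 \<le> \<tau> k" "\<tau> k \<le> t0 + 1" by (auto simp: image_subset_iff)
    then show "\<bar>u x0 (\<tau> k)\<bar> \<le> M" by (intro M) auto
  qed
qed

lemma taylor_x_uniform:
  fixes \<tau> :: "real \<Rightarrow> real"
  assumes "smooth u" "\<tau> ` {0<..1} \<subseteq> {t0..t0 + 1}" "n > 0"
  obtains M where "M \<ge> 0"
    "\<And>k s. 0 < k \<Longrightarrow> k \<le> 1 \<Longrightarrow> \<bar>s\<bar> \<le> 2 \<Longrightarrow>
      \<bar>u (x0 + s) (\<tau> k) - (\<Sum>m<n. (pd_x ^^ m) u x0 (\<tau> k) / fact m * s ^ m)\<bar> \<le> M * \<bar>s\<bar> ^ n"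
proof -
  let ?B = "\<bar>x0\<bar> + \<bar>t0\<bar> + 1"
  obtain M where M: "M \<ge> 0"
    "\<And>x t s. \<bar>x\<bar> \<le> ?B \<Longrightarrow> \<bar>t\<bar> \<le> ?B \<Longrightarrow> \<bar>s\<bar> \<le> 2 \<Longrightarrow>
       \<bar>u (x + s) t - (\<Sum>m<n. (pd_x ^^ m) u x t / fact m * s ^ m)\<bar> \<le> M * \<bar>s\<bar> ^ n"
    using taylor_x[OF assms(1,3), where B = ?B] by blast
  show ?thesis
  proof (rule that[OF M(1)], rule M(2))
    fix k :: real
    assume "0 < k" "k \<le> 1"
    with assms(2) have "t0 \<le> \<tau> k" "\<tau> k \<le> t0 + 1" by (auto simp: image_subset_iff)
    then show "\<bar>\<tau> k\<bar> \<le> ?B" by auto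
  qed auto
qed

text \<open>The linear terms at x0 + h and x0 - h cancel. The three difference quotients below gain
  one order from the same symmetry.\<close>

lemma second_order_equiv_space_mean:
  fixes \<tau> :: "real \<Rightarrow> real"
  assumes "smooth u" "\<tau> ` {0<..1} \<subseteq> {t0..t0 + 1}"
  shows "(\<lambda>h k. (u (x0 + h) (\<tau> k) + u (x0 - h) (\<tau> k)) / 2) \<simeq> (\<lambda>h k. u x0 (\<tau> k))"
proof -
  obtain M where M: "M \<ge> 0" "\<And>k s. 0 < k \<Longrightarrow> k \<le> 1 \<Longrightarrow> \<bar>s\<bar> \<le> 2 \<Longrightarrow>
      \<bar>u (x0 + s) (\<tau> k) - (\<Sum>m<2. (pd_x ^^ m) u x0 (\<tau> k) / fact m * s ^ m)\<bar> \<le> M * \<bar>s\<bar> ^ 2"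
    using taylor_x_uniform[OF assms zero_less_numeral, where ?x0.0 = x0] by blast
  show ?thesis
  proof (rule second_order_equivI[of _ _ M])
    fix h k :: real
    assume hk: "0 < h" "h \<le> 1" "0 < k" "k \<le> 1"
    have "\<bar>u (x0 + s) (\<tau> k) - (u x0 (\<tau> k) + pd_x u x0 (\<tau> k) * s)\<bar> \<le> M * \<bar>s\<bar>\<^sup>2" if "\<bar>s\<bar> \<le> 2" for s
      using M(2)[OF hk(3,4) that] by (simp add: numeral_2_eq_2)
    from this[of h] this[of "- h"]
    have "\<bar>(u (x0 + h) (\<tau> k) + u (x0 - h) (\<tau> k)) / 2 - u x0 (\<tau> k)\<bar> \<le> M * h\<^sup>2"
      using hk by (auto simp: abs_le_iff add_divide_distrib diff_divide_distrib)
    moreover have "0 \<le> M * k\<^sup>2" using M(1) by simp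
    ultimately show "\<bar>(u (x0 + h) (\<tau> k) + u (x0 - h) (\<tau> k)) / 2 - u x0 (\<tau> k)\<bar> \<le> M * (h\<^sup>2 + k\<^sup>2)"
      unfolding distrib_left by linarith
  qed
qed

lemma second_order_equiv_first_difference:
  fixes \<tau> :: "real \<Rightarrow> real"
  assumes "smooth u" "\<tau> ` {0<..1} \<subseteq> {t0..t0 + 1}"
  shows "(\<lambda>h k. (u (x0 + h) (\<tau> k) - u (x0 - h) (\<tau> k)) / (2 * h)) \<simeq> (\<lambda>h k. pd_x u x0 (\<tau> k))"
proof -
  obtain M where M: "M \<ge> 0" "\<And>k s. 0 < k \<Longrightarrow> k \<le> 1 \<Longrightarrow> \<bar>s\<bar> \<le> 2 \<Longrightarrow>
      \<bar>u (x0 + s) (\<tau> k) - (\<Sum>m<3. (pd_x ^^ m) u x0 (\<tau> k) / fact m * s ^ m)\<bar> \<le> M * \<bar>s\<bar> ^ 3"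
    using taylor_x_uniform[OF assms zero_less_numeral, where ?x0.0 = x0] by blast
  show ?thesis
  proof (rule second_order_equivI[of _ _ M])
    fix h k :: real
    assume hk: "0 < h" "h \<le> 1" "0 < k" "k \<le> 1"
    \<comment> \<open>Taylor coefficients become opaque atoms, so the combination of expansions is a
      linear problem.\<close>
    define a where "a = (\<lambda>m. (pd_x ^^ m) u x0 (\<tau> k) / fact m)"
    then have a: "(pd_x ^^ m) u x0 (\<tau> k) / fact m = a m" for m by simp
    have a1: "a 1 = pd_x u x0 (\<tau> k)" by (simp add: a_def)
    have "\<bar>u (x0 + s) (\<tau> k) - (a 0 + a 1 * s + a 2 * s\<^sup>2)\<bar> \<le> M * \<bar>s\<bar> ^ 3" if "\<bar>s\<bar> \<le> 2" for s
      using M(2)[OF hk(3,4) that] unfolding a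
      by (simp add: lessThan_nat_numeral lessThan_Suc add_ac)
    from this[of h] this[of "- h"]
    have "\<bar>(u (x0 + h) (\<tau> k) - u (x0 - h) (\<tau> k)) / 2 - a 1 * h\<bar> \<le> M * h ^ 3"
      using hk by (auto simp: abs_le_iff add_divide_distrib diff_divide_distrib)
    from abs_divide_power_le[OF hk(1) this, of 1 2]
    have "\<bar>(u (x0 + h) (\<tau> k) - u (x0 - h) (\<tau> k)) / (2 * h) - a 1\<bar> \<le> M * h\<^sup>2"
      using hk by (simp add: diff_divide_distrib)
    moreover have "0 \<le> M * k\<^sup>2" using M(1) by simp
    ultimately show "\<bar>(u (x0 + h) (\<tau> k) - u (x0 - h) (\<tau> k)) / (2 * h) - pd_x u x0 (\<tau> k)\<bar>
        \<le> M * (h\<^sup>2 + k\<^sup>2)"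
      unfolding distrib_left a1 by linarith
  qed
qed

text \<open>The cubic terms cancel, so a fourth-order remainder survives division by
  \<open>h^2\<close> as O(h^2).\<close>

lemma second_order_equiv_second_difference:
  fixes \<tau> :: "real \<Rightarrow> real"
  assumes "smooth u" "\<tau> ` {0<..1} \<subseteq> {t0..t0 + 1}"
  shows "(\<lambda>h k. (u (x0 + h) (\<tau> k) - 2 * u x0 (\<tau> k) + u (x0 - h) (\<tau> k)) / h\<^sup>2)
      \<simeq> (\<lambda>h k. pd_x (pd_x u) x0 (\<tau> k))"
proof -
  obtain M where M: "M \<ge> 0" "\<And>k s. 0 < k \<Longrightarrow> k \<le> 1 \<Longrightarrow> \<bar>s\<bar> \<le> 2 \<Longrightarrow>
      \<bar>u (x0 + s) (\<tau> k) - (\<Sum>m<4. (pd_x ^^ m) u x0 (\<tau> k) / fact m * s ^ m)\<bar> \<le> M * \<bar>s\<bar> ^ 4"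
    using taylor_x_uniform[OF assms zero_less_numeral, where ?x0.0 = x0] by blast
  show ?thesis
  proof (rule second_order_equivI[of _ _ "2 * M"])
    fix h k :: real
    assume hk: "0 < h" "h \<le> 1" "0 < k" "k \<le> 1"
    define a where "a = (\<lambda>m. (pd_x ^^ m) u x0 (\<tau> k) / fact m)"
    then have a: "(pd_x ^^ m) u x0 (\<tau> k) / fact m = a m" for m by simp
    have a0: "u x0 (\<tau> k) = a 0" and a2: "pd_x (pd_x u) x0 (\<tau> k) = 2 * a 2"
      by (simp_all add: a_def numeral_2_eq_2)
    let ?d = "u (x0 + h) (\<tau> k) - 2 * u x0 (\<tau> k) + u (x0 - h) (\<tau> k)"
    have "\<bar>u (x0 + s) (\<tau> k) - (a 0 + a 1 * s + a 2 * s\<^sup>2 + a 3 * s ^ 3)\<bar> \<le> M * \<bar>s\<bar> ^ 4"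
      if "\<bar>s\<bar> \<le> 2" for s
      using M(2)[OF hk(3,4) that] unfolding a
      by (simp add: lessThan_nat_numeral lessThan_Suc add_ac)
    from this[of h] this[of "- h"]
    have "\<bar>?d - 2 * a 2 * h\<^sup>2\<bar> \<le> 2 * M * h ^ 4"
      using hk unfolding a0 by (auto simp: abs_le_iff)
    from abs_divide_power_le[OF hk(1) this, of 2 2]
    have "\<bar>?d / h\<^sup>2 - 2 * a 2\<bar> \<le> 2 * M * h\<^sup>2"
      using hk by (simp add: diff_divide_distrib[of _ "2 * a 2 * h\<^sup>2"])
    moreover have "0 \<le> M * k\<^sup>2" using M(1) by simp
    ultimately show "\<bar>?d / h\<^sup>2 - pd_x (pd_x u) x0 (\<tau> k)\<bar> \<le> 2 * M * (h\<^sup>2 + k\<^sup>2)"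
      unfolding distrib_left a2 by linarith
  qed
qed

text \<open>The weights 1, -2, 2, -1 annihilate even terms by antisymmetry and the linear term by 2
  * 2 - 4 = 0. The cubic coefficient is 16 - 4 = 12, and half of it is 3!.\<close>

lemma second_order_equiv_third_difference:
  fixes \<tau> :: "real \<Rightarrow> real"
  assumes "smooth u" "\<tau> ` {0<..1} \<subseteq> {t0..t0 + 1}"
  shows "(\<lambda>h k. (u (x0 + 2 * h) (\<tau> k) - 2 * u (x0 + h) (\<tau> k) + 2 * u (x0 - h) (\<tau> k)
               - u (x0 - 2 * h) (\<tau> k)) / (2 * h ^ 3))
      \<simeq> (\<lambda>h k. pd_x (pd_x (pd_x u)) x0 (\<tau> k))"
proof -
  obtain M where M: "M \<ge> 0" "\<And>k s. 0 < k \<Longrightarrow> k \<le> 1 \<Longrightarrow> \<bar>s\<bar> \<le> 2 \<Longrightarrow>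
      \<bar>u (x0 + s) (\<tau> k) - (\<Sum>m<5. (pd_x ^^ m) u x0 (\<tau> k) / fact m * s ^ m)\<bar> \<le> M * \<bar>s\<bar> ^ 5"
    using taylor_x_uniform[OF assms zero_less_numeral, where ?x0.0 = x0] by blast
  show ?thesis
  \<comment> \<open>Two remainders at distance 2h give 2 * 32, two at distance h with weight 2 give
    4; half of 68 is 34.\<close>
  proof (rule second_order_equivI[of _ _ "34 * M"])
    fix h k :: real
    assume hk: "0 < h" "h \<le> 1" "0 < k" "k \<le> 1"
    define a where "a = (\<lambda>m. (pd_x ^^ m) u x0 (\<tau> k) / fact m)"
    then have a: "(pd_x ^^ m) u x0 (\<tau> k) / fact m = a m" for m by simp
    have a3: "pd_x (pd_x (pd_x u)) x0 (\<tau> k) = 6 * a 3"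
      by (simp add: a_def fact_numeral) (simp add: numeral_3_eq_3)
    let ?d = "u (x0 + 2 * h) (\<tau> k) - 2 * u (x0 + h) (\<tau> k) + 2 * u (x0 - h) (\<tau> k)
             - u (x0 - 2 * h) (\<tau> k)"
    have "\<bar>u (x0 + s) (\<tau> k) - (a 0 + a 1 * s + a 2 * s\<^sup>2 + a 3 * s ^ 3 + a 4 * s ^ 4)\<bar> \<le> M * \<bar>s\<bar> ^ 5"
      if "\<bar>s\<bar> \<le> 2" for s
      using M(2)[OF hk(3,4) that] unfolding a
      by (simp add: lessThan_nat_numeral lessThan_Suc add_ac)
    from this[of h] this[of "- h"] this[of "2 * h"] this[of "- 2 * h"]
    have "\<bar>?d / 2 - 6 * a 3 * h ^ 3\<bar> \<le> 34 * M * h ^ 5"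
      using hk by (auto simp: abs_le_iff power_mult_distrib add_divide_distrib diff_divide_distrib)
    from abs_divide_power_le[OF hk(1) this, of 3 2]
    have "\<bar>?d / (2 * h ^ 3) - 6 * a 3\<bar> \<le> 34 * M * h\<^sup>2"
      using hk by (simp add: diff_divide_distrib[of _ "6 * a 3 * h ^ 3"])
    moreover have "0 \<le> M * k\<^sup>2" using M(1) by simp
    ultimately show "\<bar>?d / (2 * h ^ 3) - pd_x (pd_x (pd_x u)) x0 (\<tau> k)\<bar> \<le> 34 * M * (h\<^sup>2 + k\<^sup>2)"
      unfolding distrib_left a3 by linarith
  qed
qed

section \<open>Boundedness of the mixed differences multiplied by lambda\<close>

text \<open>The mean value theorem in time trades the time quotient for \<open>pd_t u\<close> at an
  intermediate time, uniformly controlled. A first-order spatial expansion of \<open>pd_t u\<close>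
  then supplies the factor 2h.\<close>

lemma stays_bounded_mixed_difference:
  assumes "smooth u"
  shows "stays_bounded (\<lambda>h k. ((u (x0 + h) (t0 + k) - u (x0 - h) (t0 + k))
           - (u (x0 + h) t0 - u (x0 - h) t0)) / (2 * h * k))"
proof -
  let ?w = "pd_t u"
  let ?B = "\<bar>x0\<bar> + \<bar>t0\<bar> + 1"
  obtain M where M: "M \<ge> 0"
    "\<And>x t s. \<bar>x\<bar> \<le> ?B \<Longrightarrow> \<bar>t\<bar> \<le> ?B \<Longrightarrow> \<bar>s\<bar> \<le> 2 \<Longrightarrow>
       \<bar>?w (x + s) t - (\<Sum>m<1. (pd_x ^^ m) ?w x t / fact m * s ^ m)\<bar> \<le> M * \<bar>s\<bar> ^ 1"
    using taylor_x[OF smooth_pd_t[OF assms] zero_less_one, where B = ?B] by blast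
  show ?thesis
  proof (rule stays_boundedI[of _ M])
    fix h k :: real
    assume hk: "0 < h" "h \<le> 1" "0 < k" "k \<le> 1"
    let ?g = "\<lambda>t. u (x0 + h) t - u (x0 - h) t"
    have "DERIV ?g t :> ?w (x0 + h) t - ?w (x0 - h) t" for t
      by (intro DERIV_diff smooth_DERIV_t[OF assms])
    then obtain \<xi> where \<xi>: "t0 < \<xi>" "\<xi> < t0 + k"
      and eq: "?g (t0 + k) - ?g t0 = (t0 + k - t0) * (?w (x0 + h) \<xi> - ?w (x0 - h) \<xi>)"
      using MVT2[of t0 "t0 + k" ?g "\<lambda>t. ?w (x0 + h) t - ?w (x0 - h) t"] hk by auto
    have "\<bar>\<xi>\<bar> \<le> ?B" using \<xi> hk by auto
    then have "\<bar>?w (x0 + h) \<xi> - ?w x0 \<xi>\<bar> \<le> M * h" "\<bar>?w (x0 - h) \<xi> - ?w x0 \<xi>\<bar> \<le> M * h"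
      using M(2)[of x0 \<xi> h] M(2)[of x0 \<xi> "- h"] hk by simp_all
    then have "\<bar>?w (x0 + h) \<xi> - ?w (x0 - h) \<xi>\<bar> \<le> M * (2 * h)"
      by linarith
    then have "\<bar>?w (x0 + h) \<xi> - ?w (x0 - h) \<xi>\<bar> / (2 * h) \<le> M"
      using hk by (simp add: divide_le_eq)
    then show "\<bar>(?g (t0 + k) - ?g t0) / (2 * h * k)\<bar> \<le> M"
      unfolding eq using hk by (simp add: abs_mult)
  qed
qed

text \<open>As before, but \<open>pd_t u\<close> is expanded to second order: the linear terms
  cancel and the two remainders \<open>M * (2 * h)^2\<close> absorb the denominator
  \<open>4 * h^2\<close>.\<close>

lemma stays_bounded_mixed_second_difference:
  assumes "smooth u"
  shows "stays_bounded (\<lambda>h k. ((u (x0 + 2 * h) (t0 + k) - 2 * u x0 (t0 + k) + u (x0 - 2 * h) (t0 + k))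
           - (u (x0 + 2 * h) t0 - 2 * u x0 t0 + u (x0 - 2 * h) t0)) / (4 * h\<^sup>2 * k))"
proof -
  let ?w = "pd_t u"
  let ?B = "\<bar>x0\<bar> + \<bar>t0\<bar> + 1"
  obtain M where M: "M \<ge> 0"
    "\<And>x t s. \<bar>x\<bar> \<le> ?B \<Longrightarrow> \<bar>t\<bar> \<le> ?B \<Longrightarrow> \<bar>s\<bar> \<le> 2 \<Longrightarrow>
       \<bar>?w (x + s) t - (\<Sum>m<2. (pd_x ^^ m) ?w x t / fact m * s ^ m)\<bar> \<le> M * \<bar>s\<bar> ^ 2"
    using taylor_x[OF smooth_pd_t[OF assms] zero_less_numeral, where B = ?B] by blast
  show ?thesis
  proof (rule stays_boundedI[of _ "2 * M"])
    fix h k :: real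
    assume hk: "0 < h" "h \<le> 1" "0 < k" "k \<le> 1"
    let ?g = "\<lambda>t. u (x0 + 2 * h) t - 2 * u x0 t + u (x0 - 2 * h) t"
    let ?g' = "\<lambda>t. ?w (x0 + 2 * h) t - 2 * ?w x0 t + ?w (x0 - 2 * h) t"
    have "DERIV ?g t :> ?g' t" for t
      by (intro DERIV_add DERIV_diff DERIV_cmult smooth_DERIV_t[OF assms])
    then obtain \<xi> where \<xi>: "t0 < \<xi>" "\<xi> < t0 + k"
      and eq: "?g (t0 + k) - ?g t0 = (t0 + k - t0) * ?g' \<xi>"
      using MVT2[of t0 "t0 + k" ?g ?g'] hk by auto
    have "\<bar>\<xi>\<bar> \<le> ?B" using \<xi> hk by auto
    then have "\<bar>?w (x0 + 2 * h) \<xi> - (?w x0 \<xi> + pd_x ?w x0 \<xi> * (2 * h))\<bar> \<le> M * (2 * h)\<^sup>2"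
      "\<bar>?w (x0 - 2 * h) \<xi> - (?w x0 \<xi> - pd_x ?w x0 \<xi> * (2 * h))\<bar> \<le> M * (2 * h)\<^sup>2"
      using M(2)[of x0 \<xi> "2 * h"] M(2)[of x0 \<xi> "- 2 * h"] hk by (simp_all add: numeral_2_eq_2)
    then have "\<bar>?g' \<xi>\<bar> \<le> 2 * M * (4 * h\<^sup>2)"
      by (auto simp: abs_le_iff power_mult_distrib)
    then have "\<bar>?g' \<xi>\<bar> / (4 * h\<^sup>2) \<le> 2 * M"
      using hk by (simp add: divide_le_eq)
    then show "\<bar>(?g (t0 + k) - ?g t0) / (4 * h\<^sup>2 * k)\<bar> \<le> 2 * M"
      unfolding eq using hk by (simp add: abs_mult)
  qed
qed

section \<open>Consistency of the characteristic and of the scheme\<close>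

text \<open>Regroups the characteristic into quantities already estimated; the quadratic part uses
  (a^2 + ab + b^2)/3 = ((a + b)/2)^2 + (a - b)^2/12.\<close>

lemma Q3_eq:
  "Q3 h k l u =
     ((u 0 1 + u 0 0) / 2 * ((u 0 1 + u 0 0) / 2) + 1 / 12 * ((u 0 1 - u 0 0) * (u 0 1 - u 0 0)))
     + 2 * (1 / 2 * ((u 1 1 - 2 * u 0 1 + u (-1) 1) / h\<^sup>2)
          + 1 / 2 * ((u 1 0 - 2 * u 0 0 + u (-1) 0) / h\<^sup>2))
     + 2 * (l * (((u 1 1 - u (-1) 1) - (u 1 0 - u (-1) 0)) / (2 * h * k)))"
  unfolding Q3_def \<phi>_def difference_defs divide_inverse
  by (simp add: algebra_simps power2_eq_square power3_eq_cube) (simp add: field_simps)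

text \<open>The discrete product rule splits the central difference of the quadratic part into
  central differences times spatial means. Squares yield weight 1/3, and the mixed product yields
  1/6 for each order of the time levels.\<close>

lemma scheme_expand:
  "scheme h k l u =
     (1 / 3 * ((u 1 1 - u (-1) 1) / (2 * h) * ((u 1 1 + u (-1) 1) / 2))
      + 1 / 3 * ((u 1 0 - u (-1) 0) / (2 * h) * ((u 1 0 + u (-1) 0) / 2))
      + 1 / 6 * ((u 1 0 - u (-1) 0) / (2 * h) * ((u 1 1 + u (-1) 1) / 2))
      + 1 / 6 * ((u 1 1 - u (-1) 1) / (2 * h) * ((u 1 0 + u (-1) 0) / 2)))
     + (1 / 2 * ((u 2 1 - 2 * u 1 1 + 2 * u (-1) 1 - u (-2) 1) / (2 * h ^ 3))
      + 1 / 2 * ((u 2 0 - 2 * u 1 0 + 2 * u (-1) 0 - u (-2) 0) / (2 * h ^ 3)))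
     + l * (((u 2 1 - 2 * u 0 1 + u (-2) 1) - (u 2 0 - 2 * u 0 0 + u (-2) 0)) / (4 * h\<^sup>2 * k))
     + (u 0 1 - u 0 0) / k"
  unfolding scheme_eq \<phi>_def difference_defs divide_inverse
  by (simp add: algebra_simps power2_eq_square power3_eq_cube)

context
  fixes u :: "real \<Rightarrow> real \<Rightarrow> real" and x0 t0 :: real
  assumes u: "smooth u"
begin

lemma stencil_times:
  "(\<lambda>k. t0 + k) ` {0<..1} \<subseteq> {t0..t0 + 1}" "(\<lambda>k. t0) ` {0<..1} \<subseteq> {t0..t0 + 1}"
  "(\<lambda>k. t0 + k / 2) ` {0<..1} \<subseteq> {t0..t0 + 1}"
  by auto

lemma time_average:
  assumes "smooth v" "f1 \<simeq> (\<lambda>h k. v x0 (t0 + k))" "f0 \<simeq> (\<lambda>h k. v x0 t0)"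
  shows "(\<lambda>h k. 1 / 2 * f1 h k + 1 / 2 * f0 h k) \<simeq> (\<lambda>h k. v x0 (t0 + k / 2))"
  using second_order_equiv_trans[OF
      second_order_equiv_add[OF second_order_equiv_cmult[OF assms(2), of "1 / 2"]
        second_order_equiv_cmult[OF assms(3), of "1 / 2"]]]
    second_order_equiv_time_mean[OF assms(1), of x0 t0]
  by (simp add: add_divide_distrib)

text \<open>
  Both quadratic terms of the scheme become, at the two time levels, a product of time means plus
  one twelfth of a product of time increments.
\<close>

lemma time_product:
  assumes "smooth v" "smooth w"
  shows "(\<lambda>h k. (v x0 (t0 + k) + v x0 t0) / 2 * ((w x0 (t0 + k) + w x0 t0) / 2)
             + 1 / 12 * ((v x0 (t0 + k) - v x0 t0) * (w x0 (t0 + k) - w x0 t0)))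
         \<simeq> (\<lambda>h k. v x0 (t0 + k / 2) * w x0 (t0 + k / 2))"
  using second_order_equiv_add[OF
      second_order_equiv_mult[OF second_order_equiv_time_mean[OF assms(1)]
        second_order_equiv_time_mean[OF assms(2)]
        stays_bounded_sample[OF assms(1) stencil_times(3)]
        stays_bounded_sample[OF assms(2) stencil_times(3)]]
      second_order_equiv_cmult[OF time_increments_negligible[OF assms], of "1 / 12"]]
  by simp

lemma Q3_consistent:
  assumes "(\<lambda>(h, k). lam h k) \<in> second_order"
  shows "(\<lambda>h k. Q3 h k (lam h k) (sample u x0 t0 h k)) \<simeq> (\<lambda>h k. Q3_cont u x0 (t0 + k / 2))"
proof -
  note uxx = second_order_equiv_second_difference[OF u]
  note dispersion = time_average[OF smooth_pd_x[OF smooth_pd_x[OF u]]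
      uxx[OF stencil_times(1)] uxx[OF stencil_times(2)]]
  note perturbation = second_order_mult_stays_bounded[OF assms stays_bounded_mixed_difference[OF u, of x0 t0]]
  show ?thesis
    using second_order_equiv_add[OF second_order_equiv_add[OF time_product[OF u u]
          second_order_equiv_cmult[OF dispersion, of 2]]
        second_order_equiv_cmult[OF perturbation, of 2]]
    unfolding Q3_eq by (simp add: sample_def Q3_cont_def power2_eq_square)
qed

lemma scheme_consistent:
  assumes "(\<lambda>(h, k). lam h k) \<in> second_order"
  shows "(\<lambda>h k. scheme h k (lam h k) (sample u x0 t0 h k)) \<simeq> (\<lambda>h k. KdV u x0 (t0 + k / 2))"
proof -
  note ux = smooth_pd_x[OF u]
  note uxxx = second_order_equiv_third_difference[OF u]
  note dispersion = time_average[OF smooth_pd_x[OF smooth_pd_x[OF ux]]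
      uxxx[OF stencil_times(1)] uxxx[OF stencil_times(2)]]
  note perturbation =
    second_order_mult_stays_bounded[OF assms stays_bounded_mixed_second_difference[OF u, of x0 t0]]
  \<comment> \<open>The two factors carry independent times because the mixed products pair
    different levels.\<close>
  have product: "(\<lambda>h k. c * ((u (x0 + h) (\<tau> k) - u (x0 - h) (\<tau> k)) / (2 * h) * ((u (x0 + h) (\<sigma> k) + u (x0 - h) (\<sigma> k)) / 2)))
      \<simeq> (\<lambda>h k. c * (pd_x u x0 (\<tau> k) * u x0 (\<sigma> k)))"
    if "\<tau> ` {0<..1} \<subseteq> {t0..t0 + 1}" "\<sigma> ` {0<..1} \<subseteq> {t0..t0 + 1}" for \<tau> \<sigma> c
    using that u ux
    by (intro second_order_equiv_cmult second_order_equiv_mult second_order_equiv_first_difference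
        second_order_equiv_space_mean stays_bounded_sample)
  note products = second_order_equiv_add[OF second_order_equiv_add[OF second_order_equiv_add[OF
          product[OF stencil_times(1,1), of "1 / 3"]
          product[OF stencil_times(2,2), of "1 / 3"]]
        product[OF stencil_times(2,1), of "1 / 6"]]
      product[OF stencil_times(1,2), of "1 / 6"]]
  \<comment> \<open>The four weights recombine into a product of time means plus 1/12 of a product
    of increments, which is the form of \<open>time_product\<close>.\<close>
  have "1 / 3 * (b1 * a1) + 1 / 3 * (b0 * a0) + 1 / 6 * (b0 * a1) + 1 / 6 * (b1 * a0)
      = (b1 + b0) / 2 * ((a1 + a0) / 2) + 1 / 12 * ((b1 - b0) * (a1 - a0))" for a0 a1 b0 b1 :: real
    by (simp add: field_simps)
  note nonlinear = second_order_equiv_trans[OF products time_product[OF ux u, folded this]]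
  show ?thesis
    using second_order_equiv_add[OF second_order_equiv_add[OF second_order_equiv_add[OF
            nonlinear dispersion] perturbation] second_order_equiv_time_difference[OF u, of x0 t0]]
    unfolding scheme_expand by (simp add: sample_def KdV_def add_ac mult_ac)
qed

end

theorem mainTheorem2:
  shows
    "(\<forall>\<Delta>x \<Delta>t lam :: real. \<Delta>x > 0 \<and> \<Delta>t > 0 \<longrightarrow>
        preserves_claw \<Delta>x \<Delta>t (scheme \<Delta>x \<Delta>t lam) (\<lambda>u. 1) (F1 \<Delta>x \<Delta>t lam) G1 \<and>
        preserves_claw \<Delta>x \<Delta>t (scheme \<Delta>x \<Delta>t lam) (Q3 \<Delta>x \<Delta>t lam) (F3 \<Delta>x \<Delta>t lam) (G3 \<Delta>x)) \<and>
     (\<forall>(lam :: real \<Rightarrow> real \<Rightarrow> real) (u :: real \<Rightarrow> real \<Rightarrow> real) (x0 :: real) (t0 :: real).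
        (\<lambda>(\<Delta>x, \<Delta>t). lam \<Delta>x \<Delta>t) \<in> second_order \<and> smooth u \<longrightarrow>
        (\<lambda>(\<Delta>x, \<Delta>t). scheme \<Delta>x \<Delta>t (lam \<Delta>x \<Delta>t) (sample u x0 t0 \<Delta>x \<Delta>t)
                     - KdV u x0 (t0 + \<Delta>t / 2)) \<in> second_order \<and>
        (\<lambda>(\<Delta>x, \<Delta>t). Q3 \<Delta>x \<Delta>t (lam \<Delta>x \<Delta>t) (sample u x0 t0 \<Delta>x \<Delta>t)
                     - Q3_cont u x0 (t0 + \<Delta>t / 2)) \<in> second_order)"
proof (intro conjI allI impI)
  fix \<Delta>x \<Delta>t lam :: real
  assume "\<Delta>x > 0 \<and> \<Delta>t > 0"
  then have pos: "\<Delta>x > 0" "\<Delta>t > 0" by auto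
  \<comment> \<open>The scheme is defined in divergence form, so the mass law holds by
    unfolding.\<close>
  show "preserves_claw \<Delta>x \<Delta>t (scheme \<Delta>x \<Delta>t lam) (\<lambda>u. 1) (F1 \<Delta>x \<Delta>t lam) G1"
    by (simp add: preserves_claw_def finitely_many_shifts_fluxes scheme_def)
  show "preserves_claw \<Delta>x \<Delta>t (scheme \<Delta>x \<Delta>t lam) (Q3 \<Delta>x \<Delta>t lam) (F3 \<Delta>x \<Delta>t lam) (G3 \<Delta>x)"
    using energy_identity[OF pos]
    by (simp add: preserves_claw_def finitely_many_shifts_fluxes)
next
  fix lam u :: "real \<Rightarrow> real \<Rightarrow> real" and x0 t0 :: real
  assume "(\<lambda>(\<Delta>x, \<Delta>t). lam \<Delta>x \<Delta>t) \<in> second_order \<and> smooth u"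
  then show
    "(\<lambda>(\<Delta>x, \<Delta>t). scheme \<Delta>x \<Delta>t (lam \<Delta>x \<Delta>t) (sample u x0 t0 \<Delta>x \<Delta>t)
        - KdV u x0 (t0 + \<Delta>t / 2)) \<in> second_order"
    "(\<lambda>(\<Delta>x, \<Delta>t). Q3 \<Delta>x \<Delta>t (lam \<Delta>x \<Delta>t) (sample u x0 t0 \<Delta>x \<Delta>t)
        - Q3_cont u x0 (t0 + \<Delta>t / 2)) \<in> second_order"
    using scheme_consistent Q3_consistent unfolding second_order_equiv_def by auto
qed

end
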